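(* Let $\beta\in(0,1)$ and $\lambda<0$, and define for $x>0$ $$M_\lambda(x)=\sum_{N=0}^\infty\lambda^Nx^{\beta N}\prod_{n=1}^N\left(\frac{\Gamma(1+n\beta)}{\Gamma(n\beta+1-\beta)}-\frac{1}{\Gamma(1-\beta)}\right)^{-1}$$ (empty product equal to $1$). Then $M_\lambda$ is completely monotone. More generally, for any Bernstein function $f$, the function $x\mapsto M_\lambda\big(f(x)^{1/\beta}\big)$ is completely monotone.
   Context: A function $h:(0,\infty)\to\mathbb R$ is completely monotone if it is smooth and $(-1)^nh^{(n)}\ge0$ on $(0,\infty)$ for $n=0,1,2,\dots$. A Bernstein function is a smooth function $f:(0,\infty)\to[0,\infty)$ with $(-1)^{n-1}f^{(n)}\ge0$ on $(0,\infty)$ for all $n\in\mathbb N$. *)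

theory Defs
  imports "HOL-Analysis.Analysis"
begin

(* A function on (0,\<infinity>) is represented by a total function of type real \<Rightarrow> real whose
   values outside {0<..} are irrelevant: since {0<..} is open, neither the iterated derivatives
   at positive points nor any predicate below depends on them. *)

definition smooth_on_pos :: "(real \<Rightarrow> real) \<Rightarrow> bool" where
  "smooth_on_pos h \<longleftrightarrow> (\<forall>n. (deriv ^^ n) h differentiable_on {0<..})"

definition completely_monotone :: "(real \<Rightarrow> real) \<Rightarrow> bool" where
  "completely_monotone h \<longleftrightarrow>
     smooth_on_pos h \<and> (\<forall>n. \<forall>x>0. (-1) ^ n * (deriv ^^ n) h x \<ge> 0)"

definition bernstein_function :: "(real \<Rightarrow> real) \<Rightarrow> bool" where
  "bernstein_function f \<longleftrightarrow>
     smooth_on_pos f \<and> (\<forall>x>0. f x \<ge> 0) \<and>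
     (\<forall>n\<ge>1. \<forall>x>0. (-1) ^ (n - 1) * (deriv ^^ n) f x \<ge> 0)"

(* The power x^(\<beta>N) is written (x powr \<beta>) ^ N. For x > 0 this equals x powr (\<beta> * N); at
   x = 0 it makes the N = 0 term 1, whereas 0 powr 0 = 0. The value at 0 is needed when M_series is
   composed with the Bernstein function f = 0. *)

definition M_series :: "real \<Rightarrow> real \<Rightarrow> real \<Rightarrow> real" where
  "M_series \<beta> lam x =
     (\<Sum>N. lam ^ N * (x powr \<beta>) ^ N *
        (\<Prod>n=1..N. inverse (Gamma (1 + real n * \<beta>) / Gamma (real n * \<beta> + 1 - \<beta>)
                            - 1 / Gamma (1 - \<beta>))))"

end

theory Submission
  imports Defs "HOL-Real_Asymp.Real_Asymp"
begin

text \<open>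
  Write M(x) = g(x powr \<beta>) with g(z) = \<Sum> a(n) z^n and a(n) p(n) = \<lambda> a(n-1). The Beta integral gives
  p(n) = \<integral> 1 - q^n, where q(x) = x powr \<beta> and the integral is over (0,1) with weight
  \<beta> / \<Gamma>(1-\<beta>) (1-x) powr (-\<beta>-1). For u = (-1)^n g^(n) and v = (-1)^(n-1) g^(n-1) the recurrence
  becomes \<integral> u(z) - q^n u(q z) = \<lambda> (z u(z) - n v(z)). By induction v \<ge> 0 on [0,\<infinity>); at a first
  point z with u(z) \<le> 0 the left-hand side would be negative and the right-hand side nonnegative.
  Hence g is completely monotone, and so is its composition with a nonnegative function whose
  derivative is completely monotone.
\<close>

subsection \<open>Power series with a dilation recurrence\<close>

lemma summable_all_imp_abs_summable:
  fixes b :: "nat \<Rightarrow> real"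
  assumes "\<And>x. summable (\<lambda>j. b j * x ^ j)"
  shows "summable (\<lambda>j. \<bar>b j * z ^ j\<bar>)"
  using powser_insidea[OF assms[of "\<bar>z\<bar> + 1"], of z] by simp

lemma summable_iterate_diffs:
  fixes a :: "nat \<Rightarrow> real"
  assumes "\<And>x. summable (\<lambda>j. a j * x ^ j)"
  shows "summable (\<lambda>j. (diffs ^^ n) a j * x ^ j)"
  using assms
proof (induction n arbitrary: x)
  case (Suc n)
  then show ?case
    using termdiff_converges_all[of "(diffs ^^ n) a" x] by simp
qed simp

text \<open>Leibniz rule in coefficients. With g(z) = \<Sum> a(j) z^j, the hypotheses say that
  \<Sum> a(j) p(j) z^j = c z g(z). The left-hand sides here are the coefficients of its n-th
  derivative, which is c (z g^(n) + n g^(n-1)). At n = 0 the truncated \<open>n - 1\<close> is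
  harmless because of the factor n.\<close>

lemma iterate_diffs_recurrence:
  fixes a p :: "nat \<Rightarrow> real"
  assumes rec: "\<And>j. a (Suc j) * p (Suc j) = c * a j" and "p 0 = 0"
  shows "(diffs ^^ n) a j * p (j + n) =
    c * (real n * (diffs ^^ (n - 1)) a j + (if j = 0 then 0 else (diffs ^^ n) a (j - 1)))"
proof (induction n arbitrary: j)
  case 0
  then show ?case using assms by (cases j) auto
next
  case (Suc n)
  have "(diffs ^^ Suc n) a j * p (j + Suc n) = real (Suc j) * ((diffs ^^ n) a (Suc j) * p (Suc j + n))"
    by (simp add: diffs_def del: of_nat_Suc)
  also have "\<dots> = c * (real n * (real (Suc j) * (diffs ^^ (n - 1)) a (Suc j)) + real (Suc j) * (diffs ^^ n) a j)"
    unfolding Suc.IH by (simp add: algebra_simps)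
  also have "real n * (real (Suc j) * (diffs ^^ (n - 1)) a (Suc j)) = real n * (diffs ^^ n) a j"
    by (cases n) (simp_all add: diffs_def)
  also have "real n * (diffs ^^ n) a j + real (Suc j) * (diffs ^^ n) a j =
      real (Suc n) * (diffs ^^ n) a j + (if j = 0 then 0 else (diffs ^^ Suc n) a (j - 1))"
    by (cases j) (simp_all add: diffs_def algebra_simps)
  finally show ?case by simp
qed

lemma iterate_diffs_0: "(diffs ^^ n) a 0 = fact n * (a n :: real)"
proof -
  \<comment> \<open>Generalised to all j, since \<open>diffs\<close> shifts the index by one at each
    step of the induction.\<close>
  have "(diffs ^^ n) a j * fact j = fact (n + j) * (a (n + j) :: real)" for j
  proof (induction n arbitrary: j)
    case (Suc n)
    have "(diffs ^^ Suc n) a j * fact j = (diffs ^^ n) a (Suc j) * fact (Suc j)"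
      by (simp add: diffs_def)
    then show ?case using Suc.IH[of "Suc j"] by simp
  qed simp
  from this[of 0] show ?thesis by simp
qed

text \<open>Termwise integration: the j-th term of the difference is b(j) z^j (1 - q^(j+n)), whose
  integral is b(j) p(j+n) z^j. The hypothesis \<open>bp\<close> bounds the sum of the L1 norms,
  which justifies exchanging sum and integral.\<close>

lemma has_bochner_integral_power_series_dilation:
  fixes q :: "'a \<Rightarrow> real" and b p :: "nat \<Rightarrow> real"
  assumes p: "\<And>k. has_bochner_integral M (\<lambda>x. 1 - q x ^ k) (p k)"
    and q: "AE x in M. 0 < q x \<and> q x < 1"
    and b: "\<And>x. summable (\<lambda>j. b j * x ^ j)"
    and bp: "summable (\<lambda>j. \<bar>b j * p (j + n) * z ^ j\<bar>)"
  shows "has_bochner_integral M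
    (\<lambda>x. (\<Sum>j. b j * z ^ j) - q x ^ n * (\<Sum>j. b j * (q x * z) ^ j))
    (\<Sum>j. b j * p (j + n) * z ^ j)"
proof -
  define f where "f = (\<lambda>j x. b j * z ^ j * (1 - q x ^ (j + n)))"
  have f: "has_bochner_integral M (f j) (b j * p (j + n) * z ^ j)" for j
    using has_bochner_integral_mult_right[of "b j * z ^ j" M _ "p (j + n)"] p[of "j + n"]
    by (auto simp: f_def mult_ac)
  have nn: "AE x in M. \<forall>k. 0 \<le> 1 - q x ^ k \<and> 1 - q x ^ k \<le> 1"
    using q by eventually_elim (auto simp: power_le_one)
  \<comment> \<open>Almost everywhere 1 - q^(j+n) \<ge> 0, so each f(j) keeps one sign and its L1
    norm is the absolute value of its integral.\<close>
  have norm_f: "(\<integral>x. norm (f j x) \<partial>M) = \<bar>b j * p (j + n) * z ^ j\<bar>" for j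
  proof -
    have "AE x in M. norm (f j x) = \<bar>b j * z ^ j\<bar> * (1 - q x ^ (j + n))"
      using nn by eventually_elim (simp add: f_def abs_mult)
    then have "(\<integral>x. norm (f j x) \<partial>M) = (\<integral>x. \<bar>b j * z ^ j\<bar> * (1 - q x ^ (j + n)) \<partial>M)"
      using f[of j] p[of "j + n"] by (intro integral_cong_AE) (auto simp: has_bochner_integral_iff)
    also have "\<dots> = \<bar>b j * z ^ j\<bar> * p (j + n)"
      using p[of "j + n"] by (simp add: has_bochner_integral_iff)
    also have "\<dots> = \<bar>b j * p (j + n) * z ^ j\<bar>"
    proof -
      have "0 \<le> p (j + n)"
        using integral_nonneg_AE[OF eventually_mono[OF nn], of "\<lambda>x. 1 - q x ^ (j + n)"] p[of "j + n"]
        by (auto simp: has_bochner_integral_iff)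
      then show ?thesis by (simp add: abs_mult mult_ac)
    qed
    finally show ?thesis .
  qed
  have sum_f: "AE x in M. summable (\<lambda>j. norm (f j x))"
    using nn
  proof eventually_elim
    case (elim x)
    show ?case
    proof (rule summable_comparison_test'[OF summable_all_imp_abs_summable[OF b, of z]])
      show "norm (norm (f j x)) \<le> \<bar>b j * z ^ j\<bar>" for j
        using elim by (auto simp: f_def abs_mult intro!: mult_left_le)
    qed
  qed
  have int: "integrable M (\<lambda>x. \<Sum>j. f j x)"
    using f bp sum_f by (intro integrable_suminf) (auto simp: norm_f[simplified] has_bochner_integral_iff)
  have "(\<integral>x. (\<Sum>j. f j x) \<partial>M) = (\<Sum>j. \<integral>x. f j x \<partial>M)"
    using f bp sum_f by (intro integral_suminf) (auto simp: norm_f[simplified] has_bochner_integral_iff)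
  then have "has_bochner_integral M (\<lambda>x. \<Sum>j. f j x) (\<Sum>j. b j * p (j + n) * z ^ j)"
    using int f by (simp add: has_bochner_integral_iff)
  moreover have "(\<Sum>j. f j x) =
      (\<Sum>j. b j * z ^ j) - q x ^ n * (\<Sum>j. b j * (q x * z) ^ j)" for x
  proof -
    have "(\<lambda>j. b j * z ^ j - q x ^ n * (b j * (q x * z) ^ j)) sums
        ((\<Sum>j. b j * z ^ j) - q x ^ n * (\<Sum>j. b j * (q x * z) ^ j))"
      by (intro sums_diff sums_mult summable_sums b)
    also have "(\<lambda>j. b j * z ^ j - q x ^ n * (b j * (q x * z) ^ j)) = (\<lambda>j. f j x)"
      by (auto simp: f_def algebra_simps power_add)
    finally show ?thesis by (rule sums_unique[symmetric])
  qed
  ultimately show ?thesis by simp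
qed

section \<open>Strict alternation of signs of the derivatives\<close>

lemma integral_pos_AE:
  fixes f :: "'a \<Rightarrow> real"
  assumes M: "emeasure M (space M) \<noteq> 0" and f: "integrable M f" "AE x in M. f x > 0"
  shows "integral\<^sup>L M f > 0"
proof -
  have nn: "AE x in M. f x \<ge> 0" using f(2) by eventually_elim simp
  have "integral\<^sup>L M f \<noteq> 0"
  proof
    assume "integral\<^sup>L M f = 0"
    then have "AE x in M. f x = 0" using f(1) nn by (simp add: integral_nonneg_eq_0_iff_AE)
    with f(2) have "AE x in M. False" by eventually_elim simp
    then have "emeasure M {x \<in> space M. True} = 0" by (intro emeasure_eq_0_AE) simp
    with M show False by simp
  qed
  then show ?thesis using integral_nonneg_AE[OF nn] by simp
qed

lemma positive_dilation_moment:
  fixes q :: "'a \<Rightarrow> real" and p :: "nat \<Rightarrow> real"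
  assumes p: "\<And>k. has_bochner_integral M (\<lambda>x. 1 - q x ^ k) (p k)"
    and q: "AE x in M. 0 < q x \<and> q x < 1"
    and M: "emeasure M (space M) \<noteq> 0"
  shows "p (Suc k) > 0"
proof -
  have "AE x in M. 1 - q x ^ Suc k > 0"
    using q by eventually_elim (auto intro: power_Suc_less_one simp del: power_Suc)
  then show ?thesis
    using integral_pos_AE[OF M] p[of "Suc k"] by (metis has_bochner_integral_iff)
qed

text \<open>A minimum principle, by strong induction on n. The differentiated recurrence compares
  the signed n-th derivative at z with its values at the smaller points q z. At the first failure of
  positivity this comparison has a strict sign that the lower derivative, controlled by induction,
  contradicts. Proving strict positivity makes this first failure exist in the form of a point with
  value \<le> 0.\<close>

lemma power_series_recurrence_alternating:
  fixes q :: "'a \<Rightarrow> real" and a p :: "nat \<Rightarrow> real"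
  assumes p: "\<And>k. has_bochner_integral M (\<lambda>x. 1 - q x ^ k) (p k)"
    and q: "AE x in M. 0 < q x \<and> q x < 1"
    and M: "emeasure M (space M) \<noteq> 0"
    and a: "\<And>x. summable (\<lambda>j. a j * x ^ j)"
    and a0: "a 0 > 0"
    and rec: "\<And>j. a (Suc j) * p (Suc j) = c * a j"
    and c: "c < 0"
    and "y \<ge> 0"
  shows "(-1) ^ n * (\<Sum>j. (diffs ^^ n) a j * y ^ j) > 0"
  using \<open>y \<ge> 0\<close>
proof (induction n arbitrary: y rule: less_induct)
  case (less n)
  have p0: "p 0 = 0" using p[of 0] by (simp add: has_bochner_integral_iff)
  note p_pos = positive_dilation_moment[OF p q M]
  have a_alt: "(-1) ^ k * a k > 0" for k
  proof (induction k)
    case (Suc k)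
    have "(-1) ^ Suc k * a (Suc k) = - c / p (Suc k) * ((-1) ^ k * a k)"
      using rec[of k] p_pos[of k] by (simp add: field_simps)
    also have "\<dots> > 0" using c p_pos[of k] by (intro mult_pos_pos[OF _ Suc.IH] divide_pos_pos) auto
    finally show ?case .

  qed (use a0 in simp)
  \<comment> \<open>\<open>b\<close> holds the coefficients of g^(n), \<open>b'\<close> those of n
    g^(n-1), which is zero for n = 0, and \<open>u\<close> is (-1)^n g^(n).\<close>
  define b where "b = (diffs ^^ n) a"
  define b' where "b' = (\<lambda>j. real n * (diffs ^^ (n - 1)) a j)"
  define u where "u = (\<lambda>z. (-1) ^ n * (\<Sum>j. b j * z ^ j))"
  have b: "summable (\<lambda>j. b j * x ^ j)" for x
    unfolding b_def by (rule summable_iterate_diffs[OF a])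
  have b': "summable (\<lambda>j. b' j * x ^ j)" for x
    using summable_mult[OF summable_iterate_diffs[OF a, of "n - 1" x], of "real n"]
    by (simp add: b'_def mult.assoc)
  \<comment> \<open>Passing from n - 1 to n flips the sign, so the induction hypothesis for n - 1
    turns into an upper bound.\<close>
  have u': "(-1) ^ n * (\<Sum>j. b' j * z ^ j) \<le> 0" if "z \<ge> 0" for z
  proof (cases n)
    case 0 then show ?thesis by (simp add: b'_def)
  next
    case (Suc m)
    have "(\<Sum>j. b' j * z ^ j) = real n * (\<Sum>j. (diffs ^^ m) a j * z ^ j)"
      using suminf_mult[OF summable_iterate_diffs[OF a, of m z], of "real n"]
      by (simp add: b'_def Suc mult.assoc)
    then have "(-1) ^ n * (\<Sum>j. b' j * z ^ j) = - real n * ((-1) ^ m * (\<Sum>j. (diffs ^^ m) a j * z ^ j))"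
      by (simp add: Suc algebra_simps)
    also have "\<dots> \<le> 0"
      using less.IH[of m z] that Suc by (intro mult_nonpos_nonneg) auto
    finally show ?thesis .
  qed
  have contu: "continuous_on S u" for S
  proof -
    have "isCont (\<lambda>z. \<Sum>j. b j * z ^ j) z" for z
      using termdiffs_strong_converges_everywhere[OF b] by (rule DERIV_isCont)
    then show ?thesis unfolding u_def
      by (intro continuous_on_mult continuous_on_const continuous_at_imp_continuous_on) auto
  qed
  have u0: "u 0 > 0"
    using a_alt[of n] by (simp add: u_def b_def iterate_diffs_0 mult.left_commute)
  show ?case
  proof (rule ccontr)
    assume "\<not> ?thesis"
    then have "u y \<le> 0" by (simp add: u_def b_def)
    \<comment> \<open>By continuity the points of failure in [0,y] form a compact set. Its least
      element z is positive because u(0) > 0.\<close>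
    define S where "S = {x \<in> {0..y}. u x \<le> 0}"
    have "closed S" unfolding S_def
      by (intro continuous_closed_preimage_constant continuous_on_closed_Collect_le
          continuous_on_const contu) (auto)
    then have "compact S"
      using compact_Int_closed[of "{0..y}" S] by (simp add: S_def Int_def conj_commute cong: conj_cong)
    moreover have "S \<noteq> {}" using \<open>u y \<le> 0\<close> less.prems by (auto simp: S_def)
    ultimately obtain z where z: "z \<in> S" and z_min: "\<And>t. t \<in> S \<Longrightarrow> z \<le> t"
      using compact_attains_inf by metis
    have zu: "u z \<le> 0" "z > 0" using z u0 by (auto simp: S_def order_le_less)
    have pos: "u t > 0" if "0 \<le> t" "t < z" for t
      using z_min[of t] z that by (force simp: S_def)
    have eq: "b j * p (j + n) * z ^ j =
        c * (b' j * z ^ j + (if j = 0 then 0 else b (j - 1)) * z ^ j)" for j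
      using iterate_diffs_recurrence[of a p c n j, OF rec p0]
      by (simp add: b_def b'_def algebra_simps)
    have shift: "(\<lambda>j. (if j = 0 then 0 else b (j - 1)) * z ^ j) sums (z * (\<Sum>j. b j * z ^ j))"
    proof (rule sums_Suc_imp)
      have "(\<lambda>j. z * (b j * z ^ j)) sums (z * (\<Sum>j. b j * z ^ j))"
        by (intro sums_mult summable_sums b)
      then show "(\<lambda>j. (if Suc j = 0 then 0 else b (Suc j - 1)) * z ^ Suc j) sums
          (z * (\<Sum>j. b j * z ^ j))"
        by (simp add: mult_ac)
    qed simp
    have sums: "(\<lambda>j. b j * p (j + n) * z ^ j) sums
        (c * ((\<Sum>j. b' j * z ^ j) + z * (\<Sum>j. b j * z ^ j)))"
      unfolding eq by (intro sums_mult sums_add shift summable_sums b')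
    \<comment> \<open>The recurrence itself gives absolute convergence: by \<open>eq\<close> these
      terms are combinations of those of the everywhere convergent series of \<open>b'\<close> and
      of the shifted \<open>b\<close>.\<close>
    have "summable (\<lambda>j. \<bar>b j * p (j + n) * z ^ j\<bar>)"
    proof -
      have "summable (\<lambda>j. \<bar>b j * z ^ j\<bar>)" "summable (\<lambda>j. \<bar>b' j * z ^ j\<bar>)"
        by (rule summable_all_imp_abs_summable[OF b] summable_all_imp_abs_summable[OF b'])+
      moreover from this have "summable (\<lambda>j. \<bar>z\<bar> * \<bar>b j * z ^ j\<bar>)" by (intro summable_mult)
      then have "summable (\<lambda>j. \<bar>(if Suc j = 0 then 0 else b (Suc j - 1)) * z ^ Suc j\<bar>)"
        by (simp add: abs_mult mult_ac)
      then have "summable (\<lambda>j. \<bar>(if j = 0 then 0 else b (j - 1)) * z ^ j\<bar>)"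
        by (rule iffD1[OF summable_Suc_iff])
      ultimately have "summable (\<lambda>j. \<bar>c\<bar> * (\<bar>b' j * z ^ j\<bar> + \<bar>(if j = 0 then 0 else b (j - 1)) * z ^ j\<bar>))"
        by (intro summable_mult summable_add)
      then show ?thesis
        by (rule summable_comparison_test'[where N = 0])
          (auto simp: eq abs_mult intro!: mult_left_mono order_trans[OF abs_triangle_ineq])
    qed
    from has_bochner_integral_power_series_dilation[OF p q b this]
    have int: "has_bochner_integral M (\<lambda>x. (\<Sum>j. b j * z ^ j) - q x ^ n * (\<Sum>j. b j * (q x * z) ^ j))
        (c * ((\<Sum>j. b' j * z ^ j) + z * (\<Sum>j. b j * z ^ j)))"
      by (simp add: sums_unique[OF sums, symmetric])
    \<comment> \<open>The integrated difference multiplied by -(-1)^n, so that its pointwise sign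
      can be read off.\<close>
    define F where "F = (\<lambda>x. q x ^ n * u (q x * z) - u z)"
    have F: "has_bochner_integral M F
        (- c * ((-1) ^ n * (\<Sum>j. b' j * z ^ j) + z * u z))"
    proof -
      have "F = (\<lambda>x. - ((-1) ^ n) * ((\<Sum>j. b j * z ^ j) - q x ^ n * (\<Sum>j. b j * (q x * z) ^ j)))"
        by (auto simp: F_def u_def algebra_simps)
      moreover have "- c * ((-1) ^ n * (\<Sum>j. b' j * z ^ j) + z * u z) =
         - ((-1) ^ n) * (c * ((\<Sum>j. b' j * z ^ j) + z * (\<Sum>j. b j * z ^ j)))"
        by (simp add: u_def algebra_simps)
      ultimately show ?thesis
        using has_bochner_integral_mult_right[of "- ((-1) ^ n)", OF int] by (simp only:)
    qed
    \<comment> \<open>Here 0 < q z < z, so u(q z) > 0 by minimality of z, while -u(z) \<ge> 0. The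
      integral is thus positive, yet -c > 0 multiplies a bracket that is \<le> 0.\<close>
    have "AE x in M. F x > 0"
      using q
    proof eventually_elim
      case (elim x)
      then have "q x ^ n * u (q x * z) > 0" using zu by (intro mult_pos_pos pos) auto
      then show ?case using zu by (simp add: F_def)
    qed
    with F integral_pos_AE[OF M] have "- c * ((-1) ^ n * (\<Sum>j. b' j * z ^ j) + z * u z) > 0"
      by (metis has_bochner_integral_iff)
    moreover have "(-1) ^ n * (\<Sum>j. b' j * z ^ j) + z * u z \<le> 0"
      using u'[of z] zu by (simp add: mult_le_0_iff add_nonpos_nonpos)
    ultimately show False using c by (simp add: mult_less_0_iff)
  qed
qed

subsection \<open>Completely monotone functions\<close>

text \<open>Sign conditions through order n, with derivatives given by existence instead of iterated
  \<open>deriv\<close>. The recursion through -h' lets closure under products and composition follow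
  by induction from the ordinary product and chain rules, with no formula for higher
  derivatives.\<close>

primrec cm_upto :: "nat \<Rightarrow> (real \<Rightarrow> real) \<Rightarrow> bool" where
  "cm_upto 0 h \<longleftrightarrow> (\<forall>x>0. h x \<ge> 0)"
| "cm_upto (Suc n) h \<longleftrightarrow> (\<forall>x>0. h x \<ge> 0) \<and>
     (\<exists>h'. (\<forall>x>0. (h has_real_derivative h' x) (at x)) \<and> cm_upto n (\<lambda>x. - h' x))"

lemma cm_upto_nonneg: "cm_upto n h \<Longrightarrow> x > 0 \<Longrightarrow> h x \<ge> 0"
  by (cases n) auto

lemma has_real_derivative_cong_pos:
  assumes "(h has_real_derivative d) (at x)" "x > 0" "\<And>x. x > 0 \<Longrightarrow> h x = f x"
  shows "(f has_real_derivative d) (at x)"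
  using assms by (intro has_field_derivative_transform_within_open[OF assms(1), of "{0<..}"]) auto

lemma cm_upto_cong:
  assumes "\<And>x. x > 0 \<Longrightarrow> h x = f x"
  shows "cm_upto n h \<longleftrightarrow> cm_upto n f"
proof (cases n)
  case (Suc m)
  have "(h has_real_derivative d) (at x) \<longleftrightarrow> (f has_real_derivative d) (at x)" if "x > 0" for x d
    using has_real_derivative_cong_pos[of h d x f] has_real_derivative_cong_pos[of f d x h] assms that
    by auto
  then show ?thesis using assms Suc by simp
qed (use assms in simp)

lemma cm_upto_SucD: "cm_upto (Suc n) h \<Longrightarrow> cm_upto n h"
proof (induction n arbitrary: h)
  case (Suc n)
  then obtain h' where h': "\<forall>x>0. (h has_real_derivative h' x) (at x)" "cm_upto (Suc n) (\<lambda>x. - h' x)"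
    by (metis cm_upto.simps(2))
  with Suc.IH have "cm_upto n (\<lambda>x. - h' x)" by blast
  with h' Suc.prems show ?case by (metis cm_upto.simps(2))
qed simp

lemma cm_upto_add: "cm_upto n f \<Longrightarrow> cm_upto n g \<Longrightarrow> cm_upto n (\<lambda>x. f x + g x)"
proof (induction n arbitrary: f g)
  case (Suc n)
  then obtain f' g' where f': "\<And>x. x > 0 \<Longrightarrow> (f has_real_derivative f' x) (at x)" "cm_upto n (\<lambda>x. - f' x)"
    and g': "\<And>x. x > 0 \<Longrightarrow> (g has_real_derivative g' x) (at x)" "cm_upto n (\<lambda>x. - g' x)"
    by auto
  have "cm_upto n (\<lambda>x. - (f' x + g' x))" using Suc.IH[OF f'(2) g'(2)] by simp
  moreover have "\<forall>x>0. ((\<lambda>x. f x + g x) has_real_derivative f' x + g' x) (at x)"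
    using f' g' by (auto intro!: derivative_eq_intros)
  ultimately show ?case using Suc.prems by (auto intro!: exI[of _ "\<lambda>x. f' x + g' x"])
qed simp

lemma cm_upto_mult: "cm_upto n f \<Longrightarrow> cm_upto n g \<Longrightarrow> cm_upto n (\<lambda>x. f x * g x)"
proof (induction n arbitrary: f g)
  case (Suc n)
  then obtain f' g' where f': "\<And>x. x > 0 \<Longrightarrow> (f has_real_derivative f' x) (at x)" "cm_upto n (\<lambda>x. - f' x)"
    and g': "\<And>x. x > 0 \<Longrightarrow> (g has_real_derivative g' x) (at x)" "cm_upto n (\<lambda>x. - g' x)"
    by auto
  \<comment> \<open>-(f g)' = (-f') g + f (-g'). The undifferentiated factors are lowered to order n
    by \<open>cm_upto_SucD\<close>.\<close>
  have "cm_upto n (\<lambda>x. - f' x * g x + f x * - g' x)"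
    using Suc cm_upto_SucD f' g' by (intro cm_upto_add Suc.IH) auto
  then have "cm_upto n (\<lambda>x. - (f' x * g x + f x * g' x))" by simp
  moreover have "\<forall>x>0. ((\<lambda>x. f x * g x) has_real_derivative f' x * g x + f x * g' x) (at x)"
    using f' g' by (auto intro!: derivative_eq_intros)
  ultimately show ?case using Suc.prems by (auto intro!: exI[of _ "\<lambda>x. f' x * g x + f x * g' x"])
qed simp

lemma cm_upto_powr:
  assumes "c \<ge> 0" "s \<le> 0"
  shows "cm_upto n (\<lambda>x. c * x powr s)"
  using assms
proof (induction n arbitrary: c s)
  case (Suc n)
  have "cm_upto n (\<lambda>x. (c * - s) * x powr (s - 1))"
    using Suc.prems by (intro Suc.IH) (auto simp: mult_nonneg_nonpos)
  then have "cm_upto n (\<lambda>x. - (c * s * x powr (s - 1)))" by simp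
  moreover have "\<forall>x>0. ((\<lambda>x. c * x powr s) has_real_derivative c * s * x powr (s - 1)) (at x)"
    by (auto intro!: derivative_eq_intros)
  ultimately show ?case using Suc.prems by (auto intro!: exI[of _ "\<lambda>x. c * s * x powr (s - 1)"])
qed simp

text \<open>Treating all k at once closes the induction: minus the derivative of (-1)^k u(k)(f) is
  (-1)^(k+1) u(k+1)(f) times f', a product of two functions already covered at order n. The signs
  are required at z = 0 too, since f may vanish.\<close>

lemma cm_upto_compose:
  assumes u: "\<And>k z. (u k has_real_derivative u (Suc k) z) (at z)"
    and u_alt: "\<And>k z. z \<ge> 0 \<Longrightarrow> (-1) ^ k * u k z \<ge> 0"
    and f: "\<And>x. x > 0 \<Longrightarrow> f x \<ge> 0"
    and f': "\<And>x. x > 0 \<Longrightarrow> (f has_real_derivative f' x) (at x)"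
    and cm: "\<And>n. cm_upto n f'"
  shows "cm_upto n (\<lambda>x. (-1) ^ k * u k (f x))"
proof (induction n arbitrary: k)
  case 0
  then show ?case using u_alt f by simp
next
  case (Suc n)
  have "cm_upto n (\<lambda>x. (-1) ^ Suc k * u (Suc k) (f x) * f' x)"
    by (intro cm_upto_mult Suc.IH cm)
  then have "cm_upto n (\<lambda>x. - ((-1) ^ k * (u (Suc k) (f x) * f' x)))" by (simp add: mult.assoc)
  moreover have "\<forall>x>0. ((\<lambda>x. (-1) ^ k * u k (f x)) has_real_derivative
      (-1) ^ k * (u (Suc k) (f x) * f' x)) (at x)"
    using DERIV_chain2[OF u f'] by (auto intro!: DERIV_cmult)
  ultimately show ?case using u_alt f by auto
qed

section \<open>Passage between \<open>cm_upto\<close> and iterated derivatives\<close>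

text \<open>The sign c = 1 or c = -1 makes the induction work: if h = c f on the positive axis, then
  -h' = (-c) f' there, and the claim for \<open>deriv f\<close> applies with -c.\<close>

lemma cm_upto_higher_deriv:
  assumes "cm_upto n h" "k \<le> n" "x > 0" "\<And>x. x > 0 \<Longrightarrow> h x = c * f x" "\<bar>c\<bar> = 1"
  shows "(-1) ^ k * c * (deriv ^^ k) f x \<ge> 0 \<and>
    (k < n \<longrightarrow> (deriv ^^ k) f field_differentiable at x)"
  using assms
proof (induction k arbitrary: n h f c)
  case 0
  have cc: "c * c = 1" using \<open>\<bar>c\<bar> = 1\<close> by (auto simp: abs_if split: if_splits)
  have "f field_differentiable at x" if n: "0 < n"
  proof -
    obtain m where "n = Suc m" using n by (cases n) auto
    then obtain h' where "(h has_real_derivative h' x) (at x)" using 0 by auto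
    then have "((\<lambda>x. c * h x) has_real_derivative c * h' x) (at x)" by (rule DERIV_cmult)
    moreover have "c * h t = f t" if "t > 0" for t
      using 0(4)[OF that] cc by (simp add: mult.assoc[symmetric])
    ultimately have "(f has_real_derivative c * h' x) (at x)"
      by (rule has_real_derivative_cong_pos[OF _ \<open>x > 0\<close>])
    then show ?thesis by (auto simp: field_differentiable_def)
  qed
  then show ?case using cm_upto_nonneg[OF 0(1) 0(3)] 0(3,4) by simp
next
  case (Suc k)
  have cc: "c * c = 1" using \<open>\<bar>c\<bar> = 1\<close> by (auto simp: abs_if split: if_splits)
  obtain m where m: "n = Suc m" using Suc.prems by (cases n) auto
  then obtain h' where h': "\<And>t. t > 0 \<Longrightarrow> (h has_real_derivative h' t) (at t)" "cm_upto m (\<lambda>x. - h' x)"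
    using Suc.prems by auto
  have "- h' t = (- c) * deriv f t" if "t > 0" for t
  proof -
    have "((\<lambda>x. c * h x) has_real_derivative c * h' t) (at t)"
      using h'(1)[OF that] by (rule DERIV_cmult)
    moreover have "c * h t = f t" if "t > 0" for t
      using Suc.prems(4)[OF that] cc by (simp add: mult.assoc[symmetric])
    ultimately have "(f has_real_derivative c * h' t) (at t)"
      by (rule has_real_derivative_cong_pos[OF _ that])
    then have "deriv f t = c * h' t" by (rule DERIV_imp_deriv)
    then show ?thesis using cc by (simp add: mult.assoc[symmetric])
  qed
  from Suc.IH[OF h'(2) _ \<open>x > 0\<close> this] show ?case
    using Suc.prems m by (simp add: funpow_swap1)
qed

lemma completely_monotone_if_cm_upto:
  assumes "\<And>n. cm_upto n h"
  shows "completely_monotone h"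
proof -
  \<comment> \<open>Order n + 1 is used, since differentiability of the n-th derivative needs one
    order more than its sign.\<close>
  have "(-1) ^ n * (deriv ^^ n) h x \<ge> 0" "(deriv ^^ n) h field_differentiable at x" if "x > 0" for n x
    using cm_upto_higher_deriv[OF assms[of "Suc n"], of n x 1 h] that by auto
  then show ?thesis
    unfolding completely_monotone_def smooth_on_pos_def differentiable_on_def
    by (meson field_differentiable_imp_differentiable differentiable_at_withinI greaterThan_iff)
qed

lemma smooth_on_pos_has_derivative:
  assumes "smooth_on_pos f" "x > 0"
  shows "((deriv ^^ n) f has_real_derivative (deriv ^^ Suc n) f x) (at x)"
proof -
  have "(deriv ^^ n) f differentiable at x"
    using assms at_within_open[of x "{0<..}"]
    by (metis smooth_on_pos_def differentiable_on_def greaterThan_iff open_greaterThan)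
  then show ?thesis
    by (simp add: DERIV_deriv_iff_real_differentiable)
qed

text \<open>The functions (-1)^k f^(k+1) are nonnegative, and minus the derivative of one is the
  next. The case k = 0 says that f' satisfies the sign conditions of every order.\<close>

lemma bernstein_function_deriv_cm_upto:
  assumes "bernstein_function f"
  shows "cm_upto n (\<lambda>x. (-1) ^ k * (deriv ^^ Suc k) f x)"
proof (induction n arbitrary: k)
  have nn: "(-1) ^ k * (deriv ^^ Suc k) f x \<ge> 0" if "x > 0" for k x
    using assms that by (force simp: bernstein_function_def dest!: spec[of _ "Suc k"])
  case 0
  then show ?case using nn by simp
  case (Suc n)
  have "cm_upto n (\<lambda>x. - ((-1) ^ k * (deriv ^^ Suc (Suc k)) f x))"
    using Suc[of "Suc k"] by simp
  moreover have "\<forall>x>0. ((\<lambda>x. (-1) ^ k * (deriv ^^ Suc k) f x) has_real_derivative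
      (-1) ^ k * (deriv ^^ Suc (Suc k)) f x) (at x)"
    using assms by (intro allI impI DERIV_cmult smooth_on_pos_has_derivative)
      (auto simp: bernstein_function_def)
  ultimately show ?case using nn by (auto simp del: funpow.simps)
qed

subsection \<open>Quotients of Gamma values\<close>

text \<open>Integration by parts against the Beta integral: the derivative of F(x) = (1 - x^s) (1 -
  x)^(-\<beta>) is G minus s times the Beta integrand, and F(1) - F(0) = -1. Hence G integrates to s
  B(s, 1-\<beta>) - 1, which is then divided by \<Gamma>(1-\<beta>).\<close>

lemma has_integral_Gamma_quotient:
  fixes \<beta> s :: real
  assumes \<beta>: "0 < \<beta>" "\<beta> < 1" and s: "0 < s"
  shows "((\<lambda>x. \<beta> / Gamma (1 - \<beta>) * (1 - x) powr (-\<beta> - 1) * (1 - x powr s)) has_integral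
    Gamma (1 + s) / Gamma (s + 1 - \<beta>) - 1 / Gamma (1 - \<beta>)) {0..1}"
proof -
  define F where "F = (\<lambda>x. (1 - x powr s) * (1 - x) powr (-\<beta>))"
  define G where "G = (\<lambda>x. \<beta> * (1 - x) powr (-\<beta> - 1) * (1 - x powr s))"
  \<comment> \<open>At 1 the factor 1 - x^s vanishes to first order, so F behaves like s (1 -
    x)^(1-\<beta>) and tends to its value 0.\<close>
  have "continuous (at x within {0..1}) F" if x: "x \<in> {0..1}" for x
  proof (cases "x = 1")
    case True
    have "((\<lambda>x. (1 - x powr s) * (1 - x) powr (-\<beta>)) \<longlongrightarrow> 0) (at_left 1)"
      using \<beta> s by real_asymp
    moreover have "at (1::real) within {0..1} = at_left 1"
      by (rule at_within_Icc_at_left) simp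
    ultimately show ?thesis using True by (simp add: continuous_within F_def)
  next
    case False
    have "continuous_on {0..<1} F"
      unfolding F_def using s by (intro continuous_intros continuous_on_powr') auto
    then have "continuous (at x within {0..<1}) F"
      using x False by (auto simp: continuous_on_eq_continuous_within)
    moreover have "at x within {0..<1} = at x within {0..1}"
      using x False by (intro at_within_nhd[of x "{..<1}"]) auto
    ultimately show ?thesis by simp
  qed
  then have cont: "continuous_on {0..1} F" by (simp add: continuous_on_eq_continuous_within)
  have "((\<lambda>x. G x - s * (x powr (s - 1) * (1 - x) powr ((1 - \<beta>) - 1))) has_integral F 1 - F 0) {0..1}"
  proof (rule fundamental_theorem_of_calculus_interior[OF _ cont])
    fix x :: real assume "x \<in> {0<..<1}"
    then have "(F has_real_derivative G x - s * (x powr (s - 1) * (1 - x) powr ((1 - \<beta>) - 1))) (at x)"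
      unfolding F_def G_def
      by (auto intro!: derivative_eq_intros simp: algebra_simps)
    then show "(F has_vector_derivative G x - s * (x powr (s - 1) * (1 - x) powr ((1 - \<beta>) - 1))) (at x)"
      by (simp add: has_real_derivative_iff_has_vector_derivative)
  qed simp
  from has_integral_add[OF this has_integral_mult_right[OF has_integral_Beta_real[of s "1 - \<beta>"], of s]]
  have "(G has_integral s * Beta s (1 - \<beta>) - 1) {0..1}"
    using \<beta> s by (simp add: F_def)
  from has_integral_mult_right[OF this, of "1 / Gamma (1 - \<beta>)"]
  have "((\<lambda>x. \<beta> / Gamma (1 - \<beta>) * (1 - x) powr (-\<beta> - 1) * (1 - x powr s)) has_integral
     (s * Beta s (1 - \<beta>) - 1) / Gamma (1 - \<beta>)) {0..1}"
    by (simp add: G_def)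
  moreover have "(s * Beta s (1 - \<beta>) - 1) / Gamma (1 - \<beta>) =
      Gamma (1 + s) / Gamma (s + 1 - \<beta>) - 1 / Gamma (1 - \<beta>)"
  proof -
    have "Gamma (1 - \<beta>) > 0" using \<beta> by (intro Gamma_real_pos) auto
    moreover have "Gamma (s + 1) = s * Gamma s"
      using s by (intro Gamma_plus1) (auto elim!: nonpos_Ints_cases')
    ultimately show ?thesis by (simp add: Beta_def field_simps add_ac)
  qed
  ultimately show ?thesis by simp
qed

text \<open>Log-convexity of \<Gamma> at s + 1 - \<beta> = \<beta> s + (1-\<beta>)(1+s), combined
  with \<Gamma>(1+s) = s \<Gamma>(s). It makes p(n) tend to infinity, so that the power series
  converges everywhere.\<close>

lemma Gamma_quotient_ge_powr:
  fixes \<beta> s :: real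
  assumes \<beta>: "0 < \<beta>" "\<beta> < 1" and s: "0 < s"
  shows "s powr \<beta> \<le> Gamma (1 + s) / Gamma (s + 1 - \<beta>)"
proof -
  have pos: "Gamma s > 0" "Gamma (1 + s) > 0" "Gamma (s + 1 - \<beta>) > 0"
    using \<beta> s by (auto intro!: Gamma_real_pos)
  have G: "Gamma (1 + s) = s * Gamma s"
    using Gamma_plus1[of s] s by (simp add: add_ac nonpos_Ints_def)
  have "(ln \<circ> Gamma) ((1 - (1 - \<beta>)) *\<^sub>R s + (1 - \<beta>) *\<^sub>R (1 + s)) \<le>
      (1 - (1 - \<beta>)) * (ln \<circ> Gamma) s + (1 - \<beta>) * (ln \<circ> Gamma) (1 + s)"
    using \<beta> s by (intro convex_onD[OF log_convex_Gamma_real]) auto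
  then have "ln (Gamma (s + 1 - \<beta>)) \<le> \<beta> * ln (Gamma s) + (1 - \<beta>) * ln (Gamma (1 + s))"
    by (simp add: algebra_simps)
  also have "\<dots> = ln (Gamma (1 + s)) - \<beta> * ln s"
    unfolding G using ln_mult[of s "Gamma s"] pos s by (simp add: algebra_simps)
  finally have "exp (\<beta> * ln s) \<le> exp (ln (Gamma (1 + s)) - ln (Gamma (s + 1 - \<beta>)))"
    by simp
  then show ?thesis using pos s by (simp add: exp_diff powr_def)
qed

section \<open>Application to the series M\<close>

text \<open>Common source of both claims: M depends on its argument g(x) only through g(x)^\<beta> =
  f(x), in which it is a power series. Composition with f then applies.\<close>

lemma cm_upto_M_series_compose:
  fixes \<beta> lam :: real
  assumes \<beta>: "0 < \<beta>" "\<beta> < 1" and lam: "lam < 0"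
    and f: "\<And>x. x > 0 \<Longrightarrow> f x \<ge> 0"
    and f': "\<And>x. x > 0 \<Longrightarrow> (f has_real_derivative f' x) (at x)"
    and cm: "\<And>n. cm_upto n f'"
    and g: "\<And>x. x > 0 \<Longrightarrow> g x powr \<beta> = f x"
  shows "cm_upto n (\<lambda>x. M_series \<beta> lam (g x))"
proof -
  define p where "p = (\<lambda>n. Gamma (1 + real n * \<beta>) / Gamma (real n * \<beta> + 1 - \<beta>) - 1 / Gamma (1 - \<beta>))"
  define a where "a = (\<lambda>N. lam ^ N * (\<Prod>n=1..N. inverse (p n)))"
  define w where "w = (\<lambda>x. indicator {0<..<1} x * (\<beta> / Gamma (1 - \<beta>) * (1 - x) powr (-\<beta> - 1)) :: real)"
  define M where "M = density lborel (\<lambda>x. ennreal (w x))"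
  have Gamma_pos: "Gamma (1 - \<beta>) > 0" using \<beta> by (intro Gamma_real_pos) auto
  have w_nonneg: "w x \<ge> 0" for x using \<beta> Gamma_pos by (simp add: w_def indicator_def)
  have w_meas [measurable]: "w \<in> borel_measurable borel" unfolding w_def by measurable
  have p: "has_bochner_integral M (\<lambda>x. 1 - (x powr \<beta>) ^ k) (p k)" for k
  \<comment> \<open>The integral formula requires s = k \<beta> > 0. For k = 0 the integrand is zero
    and p(0) = 0 because \<Gamma>(1) = 1.\<close>
  proof (cases "k = 0")
    case True
    then show ?thesis by (simp add: p_def has_bochner_integral_iff)
  next
    case False
    have pow: "(x powr \<beta>) ^ k = x powr (real k * \<beta>)" if "x > 0" for x
      using that by (simp add: powr_powr mult.commute flip: powr_realpow)
    let ?F = "\<lambda>x. \<beta> / Gamma (1 - \<beta>) * (1 - x) powr (-\<beta> - 1) * (1 - x powr (real k * \<beta>))"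
    have I: "(?F has_integral p k) {0<..<1}"
      using has_integral_Gamma_quotient[OF \<beta>, of "real k * \<beta>"] False \<beta>
      by (simp add: p_def has_integral_Icc_iff_Ioo)
    have F: "?F x \<ge> 0" if "x \<in> {0<..<1}" for x
    proof -
      have "x powr (real k * \<beta>) \<le> 1" using that \<beta> by (intro powr_le1) auto
      then show ?thesis using \<beta> Gamma_pos by auto
    qed
    have w_F: "w x *\<^sub>R (1 - (x powr \<beta>) ^ k) = indicator {0<..<1} x * ?F x" for x
      by (auto simp: w_def indicator_def pow)
    \<comment> \<open>The integrand is nonnegative, so the gauge integral transfers to the Lebesgue
      integral through the nonnegative integral.\<close>
    have "has_bochner_integral lborel (\<lambda>x. w x *\<^sub>R (1 - (x powr \<beta>) ^ k)) (p k)"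
    proof (rule has_bochner_integral_nn_integral)
      show "p k \<ge> 0" using has_integral_nonneg[OF I F] .
      show "AE x in lborel. 0 \<le> w x *\<^sub>R (1 - (x powr \<beta>) ^ k)"
        unfolding w_F using F by (auto simp: indicator_def)
      show "(\<integral>\<^sup>+x. ennreal (w x *\<^sub>R (1 - (x powr \<beta>) ^ k)) \<partial>lborel) = ennreal (p k)"
        unfolding w_F using nn_integral_has_integral_lebesgue[OF F I] by simp
    qed simp
    then show ?thesis unfolding M_def
      using w_nonneg by (intro has_bochner_integral_density) auto
  qed
  have q: "AE x in M. 0 < x powr \<beta> \<and> x powr \<beta> < 1"
  proof -
    have "x powr \<beta> < 1" if "0 < x" "x < 1" for x
      using powr_less_mono2[of \<beta> x 1] that \<beta> by simp
    then have "AE x in lborel. 0 < ennreal (w x) \<longrightarrow> 0 < x powr \<beta> \<and> x powr \<beta> < 1"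
      by (intro AE_I2) (auto simp: w_def indicator_def)
    then show ?thesis unfolding M_def by (subst AE_density) auto
  qed
  have p_lim: "filterlim p at_top sequentially"
  proof (rule filterlim_at_top_mono)
    show "filterlim (\<lambda>n. (real n * \<beta>) powr \<beta> - 1 / Gamma (1 - \<beta>)) at_top sequentially"
      using \<beta> by real_asymp
    show "\<forall>\<^sub>F n in sequentially. (real n * \<beta>) powr \<beta> - 1 / Gamma (1 - \<beta>) \<le> p n"
      using eventually_gt_at_top[of 0]
    proof eventually_elim
      case (elim n)
      then show ?case
        using Gamma_quotient_ge_powr[OF \<beta>, of "real n * \<beta>"] \<beta> by (simp add: p_def)
    qed
  qed
  \<comment> \<open>A null space would make every moment p(k) zero, contradicting p
    \<longlongrightarrow> \<infinity>.\<close>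
  have M: "emeasure M (space M) \<noteq> 0"
  proof
    assume "emeasure M (space M) = 0"
    then have "AE x in M. False" by (intro AE_I[of _ _ "space M"]) auto
    then have "p k = 0" for k
      using p[of k] integral_eq_zero_AE[OF eventually_mono, of "\<lambda>_. False" M "\<lambda>x. 1 - (x powr \<beta>) ^ k"]
      by (auto simp: has_bochner_integral_iff)
    then have "p = (\<lambda>_. 0)" by auto
    with p_lim show False by (auto simp: filterlim_at_top_dense dest: spec[of _ 1])
  qed
  have p_pos: "p (Suc k) \<noteq> 0" for k
    using positive_dilation_moment[OF p q M] by (metis less_irrefl)
  have rec: "a (Suc j) * p (Suc j) = lam * a j" for j
    using p_pos[of j] by (simp add: a_def)
  have summable_a: "summable (\<lambda>j. a j * x ^ j)" for x
  proof -
    \<comment> \<open>This bound makes the ratio of consecutive terms at most 1/2; the summand 1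
      keeps p(n) positive when x = 0.\<close>
    have "\<forall>\<^sub>F n in sequentially. p n \<ge> 2 * \<bar>lam * x\<bar> + 1"
      using p_lim by (simp add: filterlim_at_top)
    then obtain N where N: "\<And>n. n \<ge> N \<Longrightarrow> p n \<ge> 2 * \<bar>lam * x\<bar> + 1"
      by (auto simp: eventually_sequentially)
    show ?thesis
    proof (rule summable_ratio_test[of "1/2" N])
      fix n assume "n \<ge> N"
      then have P: "p (Suc n) \<ge> 2 * \<bar>lam * x\<bar> + 1" using N[of "Suc n"] by simp
      have "a (Suc n) * x ^ Suc n = lam * x / p (Suc n) * (a n * x ^ n)"
        using rec[of n] p_pos[of n] by (simp add: field_simps)
      moreover have "\<bar>lam * x / p (Suc n)\<bar> \<le> 1 / 2" using P by (simp add: field_simps)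
      ultimately show "norm (a (Suc n) * x ^ Suc n) \<le> 1 / 2 * norm (a n * x ^ n)"
        unfolding real_norm_def by (metis abs_ge_zero abs_mult mult_right_mono)
    qed simp
  qed
  define u where "u = (\<lambda>k z. \<Sum>j. (diffs ^^ k) a j * z ^ j)"
  have u: "(u k has_real_derivative u (Suc k) z) (at z)" for k z
    using termdiffs_strong_converges_everywhere[OF summable_iterate_diffs[OF summable_a]]
    by (simp add: u_def)
  have u_alt: "(-1) ^ k * u k z \<ge> 0" if "z \<ge> 0" for k z
    unfolding u_def using that
    by (intro order_less_imp_le[OF power_series_recurrence_alternating[OF p q M summable_a _ rec lam]])
      (simp_all add: a_def)
  have "M_series \<beta> lam (g x) = (-1) ^ 0 * u 0 (f x)" if "x > 0" for x
    using g[OF that] by (simp add: M_series_def u_def a_def p_def mult_ac)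
  then show ?thesis
    using cm_upto_compose[OF u u_alt f f' cm, of n 0] by (subst cm_upto_cong) auto
qed

theorem corollary4p13:
  fixes \<beta> lam :: real
  assumes "0 < \<beta>" and "\<beta> < 1" and "lam < 0"
  shows "completely_monotone (M_series \<beta> lam) \<and>
         (\<forall>f. bernstein_function f \<longrightarrow>
              completely_monotone (\<lambda>x. M_series \<beta> lam (f x powr (1 / \<beta>))))"
proof (intro conjI allI impI completely_monotone_if_cm_upto)
  fix n
  show "cm_upto n (M_series \<beta> lam)"
  \<comment> \<open>Here x^\<beta> plays the role of f: its derivative is a positive multiple of a
    negative power.\<close>
  proof (rule cm_upto_M_series_compose[OF assms, where f = "\<lambda>x. x powr \<beta>" and g = "\<lambda>x. x"])
    show "((\<lambda>x. x powr \<beta>) has_real_derivative \<beta> * x powr (\<beta> - 1)) (at x)" if "x > 0" for x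
      using that by (auto intro!: derivative_eq_intros)
    show "cm_upto n (\<lambda>x. \<beta> * x powr (\<beta> - 1))" for n
      using assms by (intro cm_upto_powr) auto
  qed auto
next
  fix f n assume f: "bernstein_function f"
  show "cm_upto n (\<lambda>x. M_series \<beta> lam (f x powr (1 / \<beta>)))"
  proof (rule cm_upto_M_series_compose[OF assms, where f = f])
    show nonneg: "f x \<ge> 0" if "x > 0" for x
      using f that by (simp add: bernstein_function_def)
    show "(f has_real_derivative deriv f x) (at x)" if "x > 0" for x
      using smooth_on_pos_has_derivative[of f x 0] f that by (simp add: bernstein_function_def)
    show "cm_upto n (deriv f)" for n
      using bernstein_function_deriv_cm_upto[OF f, of n 0] by simp
    \<comment> \<open>Nonnegativity of f(x) is what lets the powers cancel; the identity also holds
      at f(x) = 0, where both powers are 0.\<close>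
    show "(f x powr (1 / \<beta>)) powr \<beta> = f x" if "x > 0" for x
      using nonneg[OF that] assms by (simp add: powr_powr)
  qed
qed

end
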